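(* Let $p\geq 1$ be an integer, $q\in(0,1)$, $\mu>-1$, $-1\leq B<A\leq 1$ and $\eta>-p$. Let $f(z)=z^p+\sum_{n=1}^{\infty}a_{n+p}z^{n+p}$ belong to $\mathcal{S}_p^{\ast}(q,\mu,A,B)$, and let $F_{\eta,p}$ be the $q$-Bernardi integral of $f$, written as $F_{\eta,p}(z)=z^p+\sum_{n=1}^{\infty}b_{n+p}z^{n+p}$. Then $$|b_{p+1}|\leq\frac{[\eta+p,q]}{[\eta+p+1,q]}\,\frac{\psi_1(A-B)}{\Lambda_{1+p}},$$ and for every integer $n\geq2$, $$|b_{p+n}|\leq\frac{[\eta+p,q]}{[\eta+p+n,q]}\,\frac{(A-B)\psi_n}{\Lambda_{n+p}}\prod_{t=1}^{n-1}\left(1+\frac{[p,q](A-B)}{[p+t,q]-[p,q]}\right).$$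
   Context: Let $\mathbb{D}=\{z\in\mathbb{C}:|z|<1\}$. For an integer $p\ge 1$, $\mathfrak{A}_p$ is the set of functions analytic in $\mathbb{D}$ of the form $f(z)=z^p+\sum_{n=1}^\infty a_{n+p}z^{n+p}$. For $q\in(0,1)$ and real $x$, $[x,q]=\frac{1-q^x}{1-q}$; for integers $n\ge1$, $[n,q]!=[1,q][2,q]\cdots[n,q]$ and $[0,q]!=1$; for $x>0$, $[x,q]_0=1$ and $[x,q]_n=[x,q][x+1,q]\cdots[x+n-1,q]$ for $n\ge 1$. For $\mu>-1$ put $\Lambda_{n+p}=\frac{[\mu+1,q]_{n+p}}{[n+p,q]!}$, and for $n\ge1$ put $\psi_n=\frac{[p,q]}{[n+p,q]-[p,q]}$. The $q$-derivative is $\partial_q f(z)=\frac{f(z)-f(qz)}{z(1-q)}$ for $z\ne0$, so that it acts on power series termwise by $\partial_q z^m=[m,q]z^{m-1}$. The operator $\mathcal{L}_q^{\mu+p-1}:\mathfrak{A}_p\to\mathfrak{A}_p$ is $\mathcal{L}_q^{\mu+p-1}f(z)=z^p+\sum_{n=1}^\infty \Lambda_{n+p}a_{n+p}z^{n+p}$. For $g,h$ analytic in $\mathbb{D}$, $g\prec h$ (subordination) means there is an analytic $w$ on $\mathbb{D}$ with $w(0)=0$, $|w(z)|<1$ and $g(z)=h(w(z))$ for all $z\in\mathbb{D}$. For $q\in(0,1)$, $\mu>-1$ and $-1\le B<A\le1$, the class $\mathcal{S}_p^{\ast}(q,\mu,A,B)$ consists of all $f\in\mathfrak{A}_p$ such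 that $$\frac{z\,\partial_q\mathcal{L}_q^{\mu+p-1}f(z)}{[p,q]\,\mathcal{L}_q^{\mu+p-1}f(z)}\prec\frac{1+Az}{1+Bz},$$ where the quotient on the left is understood to take the value $1$ at $z=0$. For $\eta>-p$ and $f\in\mathfrak{A}_p$, the $q$-Bernardi integral of $f$ is $$F_{\eta,p}(z)=\frac{[\eta+p,q]}{z^\eta}\int_0^z t^{\eta-1}f(t)\,d_qt=z^p+\sum_{n=1}^\infty\frac{[\eta+p,q]}{[\eta+p+n,q]}a_{n+p}z^{n+p},\quad z\in\mathbb{D},$$ where $\int_0^z g(t)\,d_qt=(1-q)z\sum_{k=0}^\infty q^kg(q^kz)$ is the Jackson $q$-integral; the power series may be taken as the definition. *)

theory Defs
  imports "HOL-Complex_Analysis.Complex_Analysis"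
begin

abbreviation unit_disc :: "complex set" ("\<D>") where
  "\<D> \<equiv> ball 0 1"

definition q_bracket :: "real \<Rightarrow> real \<Rightarrow> real" where
  "q_bracket q x = (1 - q powr x) / (1 - q)"

definition q_factorial :: "real \<Rightarrow> nat \<Rightarrow> real" where
  "q_factorial q n = (\<Prod>k=1..n. q_bracket q (real k))"

definition q_shifted :: "real \<Rightarrow> real \<Rightarrow> nat \<Rightarrow> real" where
  "q_shifted q x n = (\<Prod>k<n. q_bracket q (x + real k))"

text \<open>\<open>Lambda_coeff q \<mu> m\<close> is \<open>\<Lambda>\<^sub>m\<close>; the total index \<open>m = n + p\<close> is the argument.\<close>
definition Lambda_coeff :: "real \<Rightarrow> real \<Rightarrow> nat \<Rightarrow> real" where
  "Lambda_coeff q \<mu> m = q_shifted q (\<mu> + 1) m / q_factorial q m"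

definition psi_coeff :: "real \<Rightarrow> nat \<Rightarrow> nat \<Rightarrow> real" where
  "psi_coeff q p n =
     q_bracket q (real p) / (q_bracket q (real (n + p)) - q_bracket q (real p))"

text \<open>\<open>f z = z ^ p + (\<Sum>n\<ge>1. a (n + p) * z ^ (n + p))\<close> on the unit disc. Only the
  values of \<open>a\<close> at indices greater than \<open>p\<close> matter.\<close>
definition p_valent_expansion :: "nat \<Rightarrow> (complex \<Rightarrow> complex) \<Rightarrow> (nat \<Rightarrow> complex) \<Rightarrow> bool" where
  "p_valent_expansion p f a \<longleftrightarrow>
     (\<forall>z\<in>\<D>. (\<lambda>n. a (Suc n + p) * z ^ (Suc n + p)) sums (f z - z ^ p))"

definition class_A :: "nat \<Rightarrow> (complex \<Rightarrow> complex) set" where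
  "class_A p = {f. f holomorphic_on \<D> \<and> (\<exists>a. p_valent_expansion p f a)}"

definition taylor_coeff :: "(complex \<Rightarrow> complex) \<Rightarrow> nat \<Rightarrow> complex" where
  "taylor_coeff f n = fps_nth (fps_expansion f 0) n"

text \<open>The value at \<open>0\<close> is the one given by termwise action on power series.\<close>
definition q_deriv :: "real \<Rightarrow> (complex \<Rightarrow> complex) \<Rightarrow> complex \<Rightarrow> complex" where
  "q_deriv q f z =
     (if z = 0 then deriv f 0
      else (f z - f (of_real q * z)) / (z * of_real (1 - q)))"

definition L_op :: "nat \<Rightarrow> real \<Rightarrow> real \<Rightarrow> (complex \<Rightarrow> complex) \<Rightarrow> complex \<Rightarrow> complex" where
  "L_op p q \<mu> f z =
     z ^ p + (\<Sum>n. of_real (Lambda_coeff q \<mu> (Suc n + p)) * taylor_coeff f (Suc n + p)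
                    * z ^ (Suc n + p))"

definition subordinate :: "(complex \<Rightarrow> complex) \<Rightarrow> (complex \<Rightarrow> complex) \<Rightarrow> bool" where
  "subordinate g h \<longleftrightarrow>
     g holomorphic_on \<D> \<and> h holomorphic_on \<D> \<and>
     (\<exists>w. w holomorphic_on \<D> \<and> w 0 = 0 \<and> (\<forall>z\<in>\<D>. norm (w z) < 1) \<and>
          (\<forall>z\<in>\<D>. g z = h (w z)))"

text \<open>HOL's convention \<open>x / 0 = 0\<close> does not matter below. Suppose \<open>G = L_op p q \<mu> f\<close>
  vanishes at some \<open>z \<noteq> 0\<close> in the disc. As \<open>G\<close> has no zeros near but not at the origin,
  there is a last \<open>k\<close> with \<open>G (q ^ k * z) = 0\<close>; the quotient is unbounded near that point,
  so it is not holomorphic on the disc and the subordination fails.\<close>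
definition q_starlike_quotient ::
    "nat \<Rightarrow> real \<Rightarrow> real \<Rightarrow> (complex \<Rightarrow> complex) \<Rightarrow> complex \<Rightarrow> complex" where
  "q_starlike_quotient p q \<mu> f z =
     (if z = 0 then 1
      else z * q_deriv q (L_op p q \<mu> f) z / (of_real (q_bracket q (real p)) * L_op p q \<mu> f z))"

definition class_S :: "nat \<Rightarrow> real \<Rightarrow> real \<Rightarrow> real \<Rightarrow> real \<Rightarrow> (complex \<Rightarrow> complex) set" where
  "class_S p q \<mu> A B =
     {f \<in> class_A p.
        subordinate (q_starlike_quotient p q \<mu> f)
          (\<lambda>z. (1 + of_real A * z) / (1 + of_real B * z))}"

text \<open>Defined by its power series; the Jackson integral form involves \<open>z\<close> to a real power,
  whose branch cancels.\<close>
definition q_Bernardi :: "nat \<Rightarrow> real \<Rightarrow> real \<Rightarrow> (complex \<Rightarrow> complex) \<Rightarrow> complex \<Rightarrow> complex" where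
  "q_Bernardi p q \<eta> f z =
     z ^ p + (\<Sum>n. of_real (q_bracket q (\<eta> + real p) / q_bracket q (\<eta> + real p + real (Suc n)))
                    * taylor_coeff f (Suc n + p) * z ^ (Suc n + p))"

end

theory Submission
  imports Defs
begin

text \<open>
  Write \<open>c m = \<Lambda>\<^sub>m a m\<close> for the coefficients of \<open>L_op p q \<mu> f\<close> beyond the leading
  \<open>c p = 1\<close>, and \<open>1 + \<Sum>\<^sub>j g\<^sub>j z\<^sup>j\<close> for the expansion of the quotient \<open>Q\<close> that
  defines the class. Because the q-derivative acts on powers by \<open>z \<partial>\<^sub>q z\<^sup>m = [m,q] z\<^sup>m\<close>,
  the defining identity \<open>z \<partial>\<^sub>q L f = [p,q] Q L f\<close> turns, on comparing coefficients, into
  \<open>([p+n,q] - [p,q]) c (p+n) = [p,q] (\<Sum>k<n. c (p+k) g\<^sub>n\<^sub>-\<^sub>k)\<close>, which is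
  \<open>q_starlike_coeff_recurrence\<close>.

  The only analytic input is the bound \<open>norm g\<^sub>j \<le> A - B\<close>
  (\<open>moebius_subordinate_coeff_bound\<close>). It is Rogosinski's theorem on functions subordinate to
  a convex one: the image of the disc under \<open>z \<mapsto> (1 + A z) / (1 + B z)\<close> is a disc or a
  half-plane, so averaging \<open>Q\<close> over the rotations by \<open>j\<close>-th roots of unity stays in it
  while making \<open>g\<^sub>j\<close> the first nonconstant coefficient; mapping back to the disc then
  reduces the bound to Cauchy's inequality.

  With this bound the recurrence becomes the Gronwall-type inequality
  \<open>norm (c (p+n)) \<le> (A - B) \<psi>\<^sub>n (\<Sum>k<n. norm (c (p+k)))\<close>, whose solution is the product in
  the theorem (\<open>convolution_recurrence_bound\<close>). The Bernardi integral multiplies each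
  coefficient by an explicit positive factor (\<open>q_Bernardi_coeff\<close>).
\<close>

section \<open>Coefficients of functions with values in a Moebius image of the disc\<close>

text \<open>The inverse of \<open>w \<mapsto> (1 + A w) / (1 + B w)\<close> is \<open>v \<mapsto> (v - 1) / (A - B v)\<close>; the
  inequality says that this inverse takes \<open>v\<close> into the disc, without a division that could be
  by zero.\<close>
lemma moebius_image_inequality:
  fixes w :: complex and A B :: real
  assumes "norm w < 1" "-1 \<le> B" "B < A" "A \<le> 1"
  defines "v \<equiv> (1 + of_real A * w) / (1 + of_real B * w)"
  shows "norm (v - 1) < norm (of_real A - of_real B * v)"
proof -
  have "norm (of_real B * w) < 1"
    using assms by (cases "B = 0") (auto simp: norm_mult intro: le_less_trans[OF mult_left_le_one_le])
  hence nz: "1 + of_real B * w \<noteq> 0"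
    by (metis add_eq_0_iff norm_minus_cancel norm_one less_irrefl)
  have 1: "v - 1 = of_real (A - B) * w / (1 + of_real B * w)"
    and 2: "of_real A - of_real B * v = of_real (A - B) / (1 + of_real B * w)"
    using nz by (simp_all add: v_def field_simps)
  have "(A - B) * norm w < A - B" using assms by simp
  thus ?thesis
    unfolding 1 2 norm_divide norm_mult norm_of_real using nz assms
    by (simp add: divide_strict_right_mono)
qed

text \<open>After squaring, the set is \<open>{v. \<Phi> v < 0}\<close>, where the quadratic part of \<open>\<Phi>\<close> is
  \<open>(1 - B\<^sup>2) (norm v)\<^sup>2\<close> and hence convex because \<open>\<bar>B\<bar> \<le> 1\<close>. Arguing with \<open>\<Phi>\<close> avoids a
  case distinction between \<open>\<bar>B\<bar> < 1\<close>, where the set is a disc, and \<open>\<bar>B\<bar> = 1\<close>, where \<open>\<Phi>\<close> is affine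
  and the set is in general a half-plane.\<close>
lemma convex_moebius_image:
  fixes A B :: real
  assumes "-1 \<le> B" "B \<le> 1"
  shows "convex {v :: complex. norm (v - 1) < norm (of_real A - of_real B * v)}"
proof -
  define \<Phi> where "\<Phi> v = (1 - B\<^sup>2) * ((Re v)\<^sup>2 + (Im v)\<^sup>2) - 2 * (1 - A * B) * Re v + (1 - A\<^sup>2)"
    for v :: complex
  have eq: "norm (v - 1) < norm (of_real A - of_real B * v) \<longleftrightarrow> \<Phi> v < 0" for v :: complex
  proof -
    have "norm (v - 1) < norm (of_real A - of_real B * v) \<longleftrightarrow>
          (norm (v - 1))\<^sup>2 < (norm (of_real A - of_real B * v))\<^sup>2"
      by (metis norm_ge_zero power2_less_imp_less power_strict_mono zero_less_numeral)
    also have "\<dots> \<longleftrightarrow> \<Phi> v < 0"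
      unfolding cmod_power2 \<Phi>_def by (simp add: power2_eq_square algebra_simps)
    finally show ?thesis .
  qed
  have "\<Phi> (s *\<^sub>R u + t *\<^sub>R v) < 0"
    if "\<Phi> u < 0" "\<Phi> v < 0" "0 \<le> s" "0 \<le> t" "s + t = 1" for s t :: real and u v
  proof -
    have t: "t = 1 - s" using that by simp
    \<comment> \<open>the parallelogram-type identity that measures the defect of \<open>\<Phi>\<close> from being affine\<close>
    have "\<Phi> (s *\<^sub>R u + t *\<^sub>R v) =
        s * \<Phi> u + t * \<Phi> v - s * t * (1 - B\<^sup>2) * ((Re u - Re v)\<^sup>2 + (Im u - Im v)\<^sup>2)"
      unfolding \<Phi>_def t by (simp add: power2_eq_square algebra_simps)
    moreover have "1 - B\<^sup>2 \<ge> 0" using assms by (simp add: abs_square_le_1)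
    hence "s * t * (1 - B\<^sup>2) * ((Re u - Re v)\<^sup>2 + (Im u - Im v)\<^sup>2) \<ge> 0"
      using that by (intro mult_nonneg_nonneg) auto
    moreover have "s * \<Phi> u + t * \<Phi> v < 0"
    proof (cases "s = 0")
      case False
      hence "s * \<Phi> u < 0" "t * \<Phi> v \<le> 0"
        using that by (auto simp: mult_less_0_iff mult_le_0_iff)
      thus ?thesis by simp
    qed (use that in auto)
    ultimately show ?thesis by simp
  qed
  thus ?thesis by (simp add: eq convex_def)
qed

text \<open>Cauchy's inequality on the circle of radius \<open>r\<close>, followed by \<open>r \<rightarrow> 1\<close>; the function need not
  extend to the unit circle itself.\<close>
lemma norm_fps_nth_le_1:
  assumes hol: "u holomorphic_on \<D>" and bd: "\<And>z. z \<in> \<D> \<Longrightarrow> norm (u z) \<le> 1"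
    and U: "u has_fps_expansion U"
  shows "norm (fps_nth U n) \<le> 1"
proof -
  have le: "norm (fps_nth U n) \<le> 1 / r ^ n" if "0 < r" "r < 1" for r :: real
  proof -
    have "norm ((deriv ^^ n) u 0) \<le> fact n * 1 / r ^ n"
    proof (rule Cauchy_inequality)
      show "u holomorphic_on ball 0 r"
        using hol that by (auto intro: holomorphic_on_subset)
      show "continuous_on (cball 0 r) u"
        using that by (intro holomorphic_on_imp_continuous_on holomorphic_on_subset[OF hol]) auto
      show "norm (u x) \<le> 1" if "norm (0 - x) = r" for x
        using that \<open>r < 1\<close> by (intro bd) auto
    qed fact
    thus ?thesis
      using fps_nth_fps_expansion[OF U, of n] by (simp add: norm_divide divide_le_eq mult.commute)
  qed
  have "((\<lambda>r::real. 1 / r ^ n) \<longlongrightarrow> 1 / 1 ^ n) (at_left 1)"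
    by (intro tendsto_intros) auto
  moreover have "eventually (\<lambda>r::real. norm (fps_nth U n) \<le> 1 / r ^ n) (at_left 1)"
    using eventually_at_left_real[of 0 1] by (auto elim!: eventually_mono intro: le)
  ultimately show ?thesis
    by (intro tendsto_lowerbound[of "\<lambda>r::real. 1 / r ^ n"]) auto
qed

text \<open>The average of \<open>Q\<close> over the rotations by the powers of a primitive \<open>n\<close>-th root of unity
  multiplies the \<open>m\<close>-th coefficient by the mean of the \<open>m\<close>-th powers of those roots, a geometric
  sum that vanishes unless \<open>n\<close> divides \<open>m\<close>.\<close>
lemma root_of_unity_average:
  assumes hol: "Q holomorphic_on \<D>" and n: "n > 0" and F: "Q has_fps_expansion F"
  defines "\<omega> \<equiv> exp (2 * of_real pi * \<i> / of_nat n)"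
  shows "(\<lambda>z. (1 / of_nat n) * (\<Sum>j<n. Q (\<omega> ^ j * z))) holomorphic_on \<D>"
    and "(\<lambda>z. (1 / of_nat n) * (\<Sum>j<n. Q (\<omega> ^ j * z))) has_fps_expansion
           Abs_fps (\<lambda>m. if n dvd m then fps_nth F m else 0)"
proof -
  have \<omega>: "norm \<omega> = 1" by (simp add: \<omega>_def)
  have pow: "\<omega> ^ m = exp (2 * of_real pi * \<i> * of_nat m / of_nat n)" for m
    unfolding \<omega>_def exp_of_nat_mult[symmetric] by (simp add: field_simps)
  have pow1: "\<omega> ^ m = 1 \<longleftrightarrow> n dvd m" for m
    unfolding pow using n by (intro complex_root_unity_eq_1) simp
  show "(\<lambda>z. (1 / of_nat n) * (\<Sum>j<n. Q (\<omega> ^ j * z))) holomorphic_on \<D>"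
  proof (intro holomorphic_intros)
    fix j
    have "Q \<circ> (\<lambda>z. \<omega> ^ j * z) holomorphic_on \<D>"
      by (intro holomorphic_on_compose_gen[OF _ hol] holomorphic_intros)
         (auto simp: norm_mult norm_power \<omega>)
    thus "(\<lambda>z. Q (\<omega> ^ j * z)) holomorphic_on \<D>" by (simp add: o_def)
  qed
  have comp: "(\<lambda>z. Q (\<omega> ^ j * z)) has_fps_expansion Abs_fps (\<lambda>m. (\<omega> ^ j) ^ m * fps_nth F m)" for j
  proof -
    have "(Q \<circ> (\<lambda>z. \<omega> ^ j * z)) has_fps_expansion fps_compose F (fps_const (\<omega> ^ j) * fps_X)"
      by (intro has_fps_expansion_compose[OF F] fps_expansion_intros) auto
    thus ?thesis by (simp only: fps_compose_linear o_def)
  qed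
  have "(\<lambda>z. (1 / of_nat n) * (\<Sum>j<n. Q (\<omega> ^ j * z))) has_fps_expansion
      fps_const (1 / of_nat n) * (\<Sum>j<n. Abs_fps (\<lambda>m. (\<omega> ^ j) ^ m * fps_nth F m))"
    by (intro fps_expansion_intros comp)
  also have "fps_const (1 / of_nat n) * (\<Sum>j<n. Abs_fps (\<lambda>m. (\<omega> ^ j) ^ m * fps_nth F m)) =
      Abs_fps (\<lambda>m. if n dvd m then fps_nth F m else 0)"
  proof (rule fps_ext)
    fix m
    have "(\<Sum>j<n. (\<omega> ^ j) ^ m) = (if n dvd m then of_nat n else 0)"
    proof (cases "n dvd m")
      case True
      hence "(\<omega> ^ j) ^ m = 1" for j
        using pow1[of m] by (metis power_mult mult.commute power_one)
      thus ?thesis using True by simp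
    next
      case False
      have "(\<Sum>j<n. (\<omega> ^ j) ^ m) = (\<Sum>j<n. (\<omega> ^ m) ^ j)"
        by (simp add: power_mult[symmetric] mult.commute)
      also have "\<dots> = 0"
        using False pow1[of m] pow1[of "m * n"] by (simp add: sum_gp_strict power_mult)
      finally show ?thesis using False by simp
    qed
    thus "fps_nth (fps_const (1 / of_nat n) * (\<Sum>j<n. Abs_fps (\<lambda>m. (\<omega> ^ j) ^ m * fps_nth F m))) m =
        fps_nth (Abs_fps (\<lambda>m. if n dvd m then fps_nth F m else 0)) m"
      using n by (simp add: fps_sum_nth sum_distrib_right[symmetric])
  qed
  finally show "(\<lambda>z. (1 / of_nat n) * (\<Sum>j<n. Q (\<omega> ^ j * z))) has_fps_expansion
           Abs_fps (\<lambda>m. if n dvd m then fps_nth F m else 0)" .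
qed

text \<open>With \<open>R\<close> the average of \<open>Q\<close> over \<open>n\<close>-th roots of unity, convexity keeps the values of \<open>R\<close> in
  the image of the disc, so \<open>u = (R - 1) / (A - B R)\<close> is bounded by \<open>1\<close>. Since
  \<open>R = 1 + fps_nth F n * z ^ n + \<dots>\<close>, the first nonzero coefficient of \<open>u\<close> is at the earliest the
  \<open>n\<close>-th, which is \<open>fps_nth F n / (A - B)\<close>, and Cauchy's inequality applies to it.\<close>
lemma moebius_subordinate_coeff_bound:
  fixes A B :: real
  assumes AB: "-1 \<le> B" "B < A" "A \<le> 1"
    and sub: "subordinate Q (\<lambda>z. (1 + of_real A * z) / (1 + of_real B * z))"
    and F: "Q has_fps_expansion F" and n: "n > 0"
  shows "norm (fps_nth F n) \<le> A - B"
proof -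
  define P where "P = {v :: complex. norm (v - 1) < norm (of_real A - of_real B * v)}"
  from sub obtain w where hol: "Q holomorphic_on \<D>" and w0: "w 0 = 0"
    and w: "\<And>z. z \<in> \<D> \<Longrightarrow> norm (w z) < 1"
    and Qw: "\<And>z. z \<in> \<D> \<Longrightarrow> Q z = (1 + of_real A * w z) / (1 + of_real B * w z)"
    unfolding subordinate_def by blast
  have QP: "Q z \<in> P" if "z \<in> \<D>" for z
    using moebius_image_inequality[OF w[OF that] AB] Qw[OF that] by (simp add: P_def)
  have F0: "fps_nth F 0 = 1"
    using has_fps_expansion_imp_0_eq_fps_nth_0[OF F] Qw[of 0] w0 by simp
  define \<omega> where "\<omega> = exp (2 * of_real pi * \<i> / of_nat n)"
  define R where "R = (\<lambda>z. (1 / of_nat n) * (\<Sum>j<n. Q (\<omega> ^ j * z)))"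
  define G where "G = Abs_fps (\<lambda>m. if n dvd m then fps_nth F m else 0)"
  have R: "R holomorphic_on \<D>" "R has_fps_expansion G"
    using root_of_unity_average[OF hol n F] by (simp_all add: R_def G_def \<omega>_def)
  have RP: "R z \<in> P" if z: "z \<in> \<D>" for z
  proof -
    have "(\<Sum>j<n. (1 / real n) *\<^sub>R Q (\<omega> ^ j * z)) \<in> P"
    proof (rule convex_sum)
      show "convex P" unfolding P_def using AB by (intro convex_moebius_image) auto
      show "Q (\<omega> ^ j * z) \<in> P" for j
        using z by (intro QP) (simp add: norm_mult norm_power \<omega>_def)
    qed (use n in auto)
    thus ?thesis by (simp add: R_def scaleR_conv_of_real sum_distrib_left)
  qed
  define u where "u = (\<lambda>z. (R z - 1) / (of_real A - of_real B * R z))"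
  have nz: "of_real A - of_real B * R z \<noteq> 0" if "z \<in> \<D>" for z
    using RP[OF that] by (auto simp: P_def)
  have hu: "u holomorphic_on \<D>"
    unfolding u_def by (intro holomorphic_intros R nz)
  have ubd: "norm (u z) \<le> 1" if "z \<in> \<D>" for z
    using RP[OF that] by (auto simp: u_def P_def norm_divide divide_le_eq_1)
  define U where "U = fps_expansion u 0"
  have U: "u has_fps_expansion U"
    unfolding U_def by (rule has_fps_expansion_fps_expansion[OF _ _ hu]) auto
  \<comment> \<open>clear the denominator of \<open>u\<close> and compare coefficients in \<open>u (A - B R) = R - 1\<close>\<close>
  define V where "V = fps_const (of_real A) - fps_const (of_real B) * G"
  have uV: "(\<lambda>z. u z * (of_real A - of_real B * R z)) has_fps_expansion U * V"
    unfolding V_def by (intro fps_expansion_intros U R)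
  have ev: "eventually (\<lambda>z. u z * (of_real A - of_real B * R z) = R z - 1) (nhds 0)"
  proof (rule eventually_mono)
    show "eventually (\<lambda>z. z \<in> \<D>) (nhds (0::complex))"
      by (intro eventually_nhds_in_open) auto
    show "u z * (of_real A - of_real B * R z) = R z - 1" if "z \<in> \<D>" for z
      unfolding u_def using nz[OF that] by (rule nonzero_eq_divide_eq[THEN iffD1, OF _ refl])
  qed
  have "(\<lambda>z. R z - 1) has_fps_expansion U * V"
    by (rule iffD1[OF has_fps_expansion_cong[OF ev refl] uV])
  moreover have "(\<lambda>z. R z - 1) has_fps_expansion G - 1"
    by (intro fps_expansion_intros R)
  ultimately have UV: "U * V = G - 1" by (rule fps_expansion_unique_complex)
  have V0: "fps_nth V 0 = of_real (A - B)" by (simp add: V_def G_def F0)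
  have Vj: "fps_nth V j = 0" if "0 < j" "j < n" for j
    using that by (auto simp: V_def G_def dest: dvd_imp_le)
  have U0: "fps_nth U 0 = 0"
    using arg_cong[OF UV, of "\<lambda>f. fps_nth f 0"] V0 AB by (simp add: G_def F0)
  have "fps_nth (U * V) n = fps_nth U n * of_real (A - B)"
  proof -
    have "fps_nth (U * V) n = (\<Sum>i=0..n. fps_nth U i * fps_nth V (n - i))"
      by (simp add: fps_mult_nth)
    also have "\<dots> = (\<Sum>i\<in>{n}. fps_nth U i * fps_nth V (n - i))"
    proof (intro sum.mono_neutral_right ballI)
      fix i assume "i \<in> {0..n} - {n}"
      thus "fps_nth U i * fps_nth V (n - i) = 0"
        using U0 Vj[of "n - i"] by (cases "i = 0") auto
    qed auto
    finally show ?thesis by (simp add: V0)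
  qed
  hence "fps_nth F n = fps_nth U n * of_real (A - B)"
    using n by (simp add: UV G_def)
  moreover have "norm (fps_nth U n) \<le> 1" by (rule norm_fps_nth_le_1[OF hu ubd U])
  hence "norm (fps_nth U n) * (A - B) \<le> 1 * (A - B)"
    using AB by (intro mult_right_mono) auto
  ultimately show ?thesis using AB by (simp add: norm_mult del: of_real_diff)
qed

section \<open>The q-brackets\<close>

lemma q_bracket_strict_mono:
  assumes "0 < q" "q < 1" "x < y"
  shows "q_bracket q x < q_bracket q y"
  using assms by (simp add: q_bracket_def divide_strict_right_mono powr_less_mono')

lemma q_bracket_pos:
  assumes "0 < q" "q < 1" "0 < x"
  shows "0 < q_bracket q x"
  using q_bracket_strict_mono[OF assms] assms by (simp add: q_bracket_def)

lemma q_bracket_le: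
  assumes "0 < q" "q < 1"
  shows "q_bracket q x \<le> 1 / (1 - q)"
  using assms by (simp add: q_bracket_def divide_right_mono)

lemma q_bracket_ge_1:
  assumes "0 < q" "q < 1" "1 \<le> x"
  shows "1 \<le> q_bracket q x"
  using assms powr_mono'[of 1 x q] by (simp add: q_bracket_def)

lemma Lambda_coeff_pos:
  assumes "0 < q" "q < 1" "\<mu> > -1"
  shows "0 < Lambda_coeff q \<mu> m"
  unfolding Lambda_coeff_def q_shifted_def q_factorial_def using assms
  by (intro divide_pos_pos prod_pos ballI q_bracket_pos) auto

text \<open>A crude geometric bound: all that it has to give is a positive radius of convergence for
  \<open>L_op p q \<mu> f\<close>, since coefficients are compared only near the origin.\<close>
lemma Lambda_coeff_le:
  assumes "0 < q" "q < 1" "\<mu> > -1"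
  shows "Lambda_coeff q \<mu> m \<le> (1 / (1 - q)) ^ m"
proof -
  have "q_shifted q (\<mu> + 1) m \<le> (\<Prod>k<m. 1 / (1 - q))"
    unfolding q_shifted_def using assms
    by (intro prod_mono) (auto intro!: less_imp_le[OF q_bracket_pos] q_bracket_le)
  moreover have "1 \<le> q_factorial q m"
    unfolding q_factorial_def using assms by (intro prod_ge_1 q_bracket_ge_1) auto
  ultimately have "q_shifted q (\<mu> + 1) m / q_factorial q m \<le> (1 / (1 - q)) ^ m / 1"
    using assms by (intro frac_le) auto
  thus ?thesis by (simp add: Lambda_coeff_def)
qed

section \<open>Power series at the origin\<close>

text \<open>The series \<open>z\<^sup>p + (\<Sum>m>p. c m z\<^sup>m)\<close>; as in \<open>p_valent_expansion\<close>, values of \<open>c\<close> at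
  indices up to \<open>p\<close> do not matter.\<close>
definition p_valent_fps :: "nat \<Rightarrow> (nat \<Rightarrow> complex) \<Rightarrow> complex fps" where
  "p_valent_fps p c = Abs_fps (\<lambda>m. if m < p then 0 else if m = p then 1 else c m)"

lemma has_fps_expansion_p_valentI:
  assumes "r > 0"
    and "\<And>z. norm z < r \<Longrightarrow> (\<lambda>n. c (Suc n + p) * z ^ (Suc n + p)) sums (g z - z ^ p)"
  shows "g has_fps_expansion p_valent_fps p c"
proof (rule has_fps_expansionI)
  have "eventually (\<lambda>z::complex. z \<in> ball 0 r) (nhds 0)"
    using assms(1) by (intro eventually_nhds_in_open) auto
  thus "eventually (\<lambda>z. (\<lambda>m. fps_nth (p_valent_fps p c) m * z ^ m) sums g z) (nhds 0)"
  proof eventually_elim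
    case (elim z)
    let ?g = "\<lambda>m. fps_nth (p_valent_fps p c) m * z ^ m"
    have "(\<lambda>n. ?g (n + Suc p)) sums (g z - z ^ p)"
      using assms(2)[of z] elim by (simp add: p_valent_fps_def)
    hence "?g sums (g z - z ^ p + (\<Sum>i<Suc p. ?g i))"
      by (subst (asm) sums_iff_shift)
    thus ?case by (simp add: p_valent_fps_def)
  qed
qed

text \<open>Multipliers of at most geometric growth shrink the disc of convergence to radius \<open>1 / K\<close> at
  worst. Both \<open>L_op\<close> (with \<open>K = 1 / (1 - q)\<close>) and \<open>q_Bernardi\<close> (with \<open>K = 1\<close>) have this form.\<close>
lemma p_valent_multiplier_has_fps_expansion:
  fixes l :: "nat \<Rightarrow> real"
  assumes hol: "f holomorphic_on \<D>" and K: "K \<ge> 1"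
    and l: "\<And>m. m > p \<Longrightarrow> \<bar>l m\<bar> \<le> K ^ m"
  shows "(\<lambda>z. z ^ p + (\<Sum>n. of_real (l (Suc n + p)) * taylor_coeff f (Suc n + p) * z ^ (Suc n + p)))
           has_fps_expansion p_valent_fps p (\<lambda>m. of_real (l m) * taylor_coeff f m)"
proof (rule has_fps_expansion_p_valentI[of "1 / K"])
  show "1 / K > 0" using K by simp
  fix z :: complex assume z: "norm z < 1 / K"
  have rad: "fps_conv_radius (fps_expansion f 0) \<ge> 1"
    using hol by (intro conv_radius_fps_expansion) (simp add: one_ereal_def)
  have "norm (of_real K * z) < 1"
    using z K by (simp add: norm_mult field_simps)
  hence "ereal (norm (of_real K * z)) < fps_conv_radius (fps_expansion f 0)"
    by (intro less_le_trans[OF _ rad]) (simp add: one_ereal_def)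
  hence "summable (\<lambda>m. norm (taylor_coeff f m * (of_real K * z) ^ m))"
    unfolding taylor_coeff_def by (rule norm_summable_fps)
  hence "summable (\<lambda>n. norm (taylor_coeff f (n + Suc p) * (of_real K * z) ^ (n + Suc p)))"
    by (subst summable_iff_shift)
  hence "summable (\<lambda>n. of_real (l (Suc n + p)) * taylor_coeff f (Suc n + p) * z ^ (Suc n + p))"
  proof (rule summable_comparison_test'[where N = 0])
    fix n
    have "norm (of_real (l (Suc n + p)) * taylor_coeff f (Suc n + p) * z ^ (Suc n + p)) =
        \<bar>l (Suc n + p)\<bar> * (norm (taylor_coeff f (Suc n + p)) * norm z ^ (Suc n + p))"
      by (simp add: norm_mult norm_power)
    also have "\<dots> \<le> K ^ (Suc n + p) * (norm (taylor_coeff f (Suc n + p)) * norm z ^ (Suc n + p))"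
      by (intro mult_right_mono l) auto
    also have "\<dots> = norm (taylor_coeff f (n + Suc p) * (of_real K * z) ^ (n + Suc p))"
      using K by (simp add: norm_mult norm_power power_mult_distrib)
    finally show "norm (of_real (l (Suc n + p)) * taylor_coeff f (Suc n + p) * z ^ (Suc n + p)) \<le>
        norm (taylor_coeff f (n + Suc p) * (of_real K * z) ^ (n + Suc p))" .
  qed
  thus "(\<lambda>n. of_real (l (Suc n + p)) * taylor_coeff f (Suc n + p) * z ^ (Suc n + p)) sums
      (z ^ p + (\<Sum>n. of_real (l (Suc n + p)) * taylor_coeff f (Suc n + p) * z ^ (Suc n + p)) - z ^ p)"
    by (simp add: summable_sums)
qed

section \<open>The coefficient recurrence\<close>

text \<open>Near the origin \<open>L f\<close> has no zero except at \<open>0\<close>, so there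
  \<open>(L f z - L f (q z)) / (1 - q) = [p,q] L f z Q z\<close> holds without any division by \<open>L f\<close>, also at
  \<open>z = 0\<close>. The left side multiplies the \<open>m\<close>-th coefficient by \<open>(1 - q ^ m) / (1 - q)\<close>, and the
  right side is a Cauchy product.\<close>
lemma q_starlike_coeff_recurrence:
  assumes q: "0 < q" "q < 1" and p: "p \<ge> 1"
    and G: "L_op p q \<mu> f has_fps_expansion p_valent_fps p c"
    and F: "q_starlike_quotient p q \<mu> f has_fps_expansion F"
  shows "of_real (q_bracket q (real m)) * fps_nth (p_valent_fps p c) m =
         of_real (q_bracket q (real p)) * (\<Sum>i=0..m. fps_nth (p_valent_fps p c) i * fps_nth F (m - i))"
proof -
  let ?G = "p_valent_fps p c" and ?L = "L_op p q \<mu> f" and ?Q = "q_starlike_quotient p q \<mu> f"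
  let ?pq = "complex_of_real (q_bracket q (real p))"
  have pq: "?pq \<noteq> 0" using q_bracket_pos[of q "real p"] q p by simp
  have G0: "?G \<noteq> 0"
  proof
    assume "?G = 0"
    hence "fps_nth ?G p = 0" by simp
    thus False by (simp add: p_valent_fps_def)
  qed
  have L0: "?L 0 = 0"
    using has_fps_expansion_imp_0_eq_fps_nth_0[OF G] p by (simp add: p_valent_fps_def)
  have comp: "(\<lambda>z. ?L (of_real q * z)) has_fps_expansion Abs_fps (\<lambda>m. of_real q ^ m * fps_nth ?G m)"
  proof -
    have "(?L \<circ> (\<lambda>z. of_real q * z)) has_fps_expansion fps_compose ?G (fps_const (of_real q) * fps_X)"
      by (intro has_fps_expansion_compose[OF G] fps_expansion_intros) auto
    thus ?thesis by (simp only: fps_compose_linear o_def)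
  qed
  have "eventually (\<lambda>z. ?L z \<noteq> 0) (at 0)"
    using has_laurent_expansion_eventually_nonzero_iff'[OF has_laurent_expansion_fps[OF G]] G0 by simp
  hence "eventually (\<lambda>z. z \<noteq> 0 \<longrightarrow> ?L z \<noteq> 0) (nhds 0)"
    by (simp add: eventually_at_filter)
  hence ev: "eventually (\<lambda>z. ?pq * (?L z * ?Q z) = (1 / of_real (1 - q)) * (?L z - ?L (of_real q * z))) (nhds 0)"
  proof eventually_elim
    case (elim z)
    show ?case
    proof (cases "z = 0")
      case False
      thus ?thesis using elim pq q by (simp add: q_starlike_quotient_def q_deriv_def)
    qed (simp add: L0)
  qed
  have lhs: "(\<lambda>z. ?pq * (?L z * ?Q z)) has_fps_expansion fps_const ?pq * (?G * F)"
    by (intro fps_expansion_intros G F)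
  have rhs: "(\<lambda>z. (1 / of_real (1 - q)) * (?L z - ?L (of_real q * z))) has_fps_expansion
      fps_const (1 / of_real (1 - q)) * (?G - Abs_fps (\<lambda>m. of_real q ^ m * fps_nth ?G m))"
    by (intro fps_expansion_intros G comp)
  have "fps_const ?pq * (?G * F) =
      fps_const (1 / of_real (1 - q)) * (?G - Abs_fps (\<lambda>m. of_real q ^ m * fps_nth ?G m))"
    by (rule fps_expansion_unique_complex[OF iffD1[OF has_fps_expansion_cong[OF ev refl] lhs] rhs])
  from arg_cong[OF this, of "\<lambda>h. fps_nth h m"]
  have "?pq * fps_nth (?G * F) m =
      (1 / of_real (1 - q)) * (fps_nth ?G m - of_real q ^ m * fps_nth ?G m)"
    by (simp only: fps_mult_left_const_nth fps_sub_nth fps_nth_Abs_fps)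
  also have "\<dots> = of_real (q_bracket q (real m)) * fps_nth ?G m"
    using q by (simp add: q_bracket_def powr_realpow algebra_simps diff_divide_distrib)
  finally show ?thesis by (simp only: fps_mult_nth)
qed

text \<open>The recurrence gives \<open>norm (c n) \<le> D \<psi>\<^sub>n S\<^sub>n\<close> for the partial sums
  \<open>S\<^sub>n = (\<Sum>k<n. norm (c k))\<close>, hence \<open>S\<^sub>n\<^sub>+\<^sub>1 \<le> (1 + D \<psi>\<^sub>n) S\<^sub>n\<close>, and the product arises by
  iterating from \<open>S\<^sub>1 = 1\<close>.\<close>
lemma convolution_recurrence_bound:
  fixes c g :: "nat \<Rightarrow> complex" and \<psi> :: "nat \<Rightarrow> real"
  assumes c0: "c 0 = 1" and D: "D \<ge> 0" and \<psi>: "\<And>n. n > 0 \<Longrightarrow> \<psi> n \<ge> 0"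
    and g: "\<And>n. n > 0 \<Longrightarrow> norm (g n) \<le> D"
    and rec: "\<And>n. n > 0 \<Longrightarrow> c n = of_real (\<psi> n) * (\<Sum>k<n. c k * g (n - k))"
    and n: "n > 0"
  shows "norm (c n) \<le> D * \<psi> n * (\<Prod>t=1..n-1. 1 + \<psi> t * D)"
proof -
  have step: "norm (c n) \<le> D * \<psi> n * (\<Sum>k<n. norm (c k))" if "n > 0" for n
  proof -
    have "norm (\<Sum>k<n. c k * g (n - k)) \<le> (\<Sum>k<n. norm (c k) * D)"
      by (intro sum_norm_le) (auto simp: norm_mult intro!: mult_left_mono g)
    hence "\<psi> n * norm (\<Sum>k<n. c k * g (n - k)) \<le> \<psi> n * (\<Sum>k<n. norm (c k) * D)"
      using \<psi>[OF that] by (intro mult_left_mono)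
    thus ?thesis
      using \<psi>[OF that]
      by (subst rec[OF that]) (simp add: norm_mult sum_distrib_right[symmetric] mult.assoc mult.left_commute
            mult.commute[of _ D] sum_distrib_left[symmetric])
  qed
  have sum: "(\<Sum>k<Suc m. norm (c k)) \<le> (\<Prod>t=1..m. 1 + \<psi> t * D)" for m
  proof (induction m)
    case (Suc m)
    have "(\<Sum>k<Suc (Suc m). norm (c k)) \<le> (\<Sum>k<Suc m. norm (c k)) * (1 + \<psi> (Suc m) * D)"
      using step[of "Suc m"] by (simp add: algebra_simps)
    also have "\<dots> \<le> (\<Prod>t=1..m. 1 + \<psi> t * D) * (1 + \<psi> (Suc m) * D)"
      using Suc D \<psi>[of "Suc m"] by (intro mult_right_mono) auto
    finally show ?case by simp
  qed (simp add: c0)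
  have "D * \<psi> n * (\<Sum>k<n. norm (c k)) \<le> D * \<psi> n * (\<Prod>t=1..n-1. 1 + \<psi> t * D)"
    using sum[of "n - 1"] n D \<psi>[OF n] by (intro mult_left_mono) auto
  thus ?thesis using step[OF n] by linarith
qed

text \<open>The coefficient estimate for the class itself. The recurrence for the full series becomes one
  for the shifted coefficients \<open>c k\<close> of index \<open>p + k\<close> on dropping the vanishing terms below \<open>p\<close>
  and moving the term \<open>k = n\<close>, whose factor is \<open>Q 0 = 1\<close>, to the left.\<close>
lemma class_S_taylor_coeff_bound:
  assumes p: "p \<ge> 1" and q: "0 < q" "q < 1" and \<mu>: "\<mu> > -1"
    and AB: "-1 \<le> B" "B < A" "A \<le> 1"
    and f: "f \<in> class_S p q \<mu> A B" and n: "n > 0"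
  shows "norm (taylor_coeff f (p + n)) \<le> (A - B) * psi_coeff q p n / Lambda_coeff q \<mu> (n + p)
           * (\<Prod>t=1..n-1. 1 + psi_coeff q p t * (A - B))"
proof -
  let ?c = "\<lambda>m. of_real (Lambda_coeff q \<mu> m) * taylor_coeff f m"
  let ?G = "p_valent_fps p ?c" and ?Q = "q_starlike_quotient p q \<mu> f"
  have hol: "f holomorphic_on \<D>"
    and sub: "subordinate ?Q (\<lambda>z. (1 + of_real A * z) / (1 + of_real B * z))"
    using f by (auto simp: class_S_def class_A_def)
  have G: "L_op p q \<mu> f has_fps_expansion ?G"
    unfolding L_op_def
  proof (rule p_valent_multiplier_has_fps_expansion[OF hol])
    show "1 \<le> 1 / (1 - q)" using q by simp
    show "\<bar>Lambda_coeff q \<mu> m\<bar> \<le> (1 / (1 - q)) ^ m" for m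
      using Lambda_coeff_le[OF q \<mu>] Lambda_coeff_pos[OF q \<mu>, of m] by simp
  qed
  define F where "F = fps_expansion ?Q 0"
  have F: "?Q has_fps_expansion F"
    unfolding F_def using sub
    by (intro has_fps_expansion_fps_expansion[of \<D>]) (auto simp: subordinate_def)
  have F0: "fps_nth F 0 = 1"
    using has_fps_expansion_imp_0_eq_fps_nth_0[OF F] by (simp add: q_starlike_quotient_def)
  have gap: "q_bracket q (real (n + p)) - q_bracket q (real p) > 0" if "n > 0" for n
    using q_bracket_strict_mono[OF q, of "real p" "real (n + p)"] that by simp
  define c where "c k = fps_nth ?G (p + k)" for k
  have "norm (c n) \<le> (A - B) * psi_coeff q p n * (\<Prod>t=1..n-1. 1 + psi_coeff q p t * (A - B))"
  proof (rule convolution_recurrence_bound[where g = "fps_nth F"])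
    show "c 0 = 1" by (simp add: c_def p_valent_fps_def)
    show "0 \<le> psi_coeff q p n" if "n > 0" for n
      unfolding psi_coeff_def using gap[OF that] q_bracket_pos[OF q, of "real p"] p by simp
    show "norm (fps_nth F n) \<le> A - B" if "n > 0" for n
      by (rule moebius_subordinate_coeff_bound[OF AB sub F that])
    show "c n = of_real (psi_coeff q p n) * (\<Sum>k<n. c k * fps_nth F (n - k))" if n: "n > 0" for n
    proof -
      let ?b = "\<lambda>x. complex_of_real (q_bracket q x)"
      let ?S = "\<Sum>k<n. c k * fps_nth F (n - k)"
      have "(\<Sum>i=0..p+n. fps_nth ?G i * fps_nth F (p + n - i)) =
          (\<Sum>i=p..p+n. fps_nth ?G i * fps_nth F (p + n - i))"
        by (intro sum.mono_neutral_right) (auto simp: p_valent_fps_def)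
      also have "\<dots> = (\<Sum>k=0..n. c k * fps_nth F (n - k))"
        by (rule sum.reindex_bij_witness[of _ "\<lambda>k. p + k" "\<lambda>i. i - p"]) (auto simp: c_def add.commute)
      also have "{0..n} = insert n {..<n}" by auto
      also have "(\<Sum>k\<in>insert n {..<n}. c k * fps_nth F (n - k)) = c n + ?S"
        by (simp add: F0)
      finally have "?b (real (n + p)) * c n = ?b (real p) * (c n + ?S)"
        using q_starlike_coeff_recurrence[OF q p G F, of "p + n"] by (simp add: c_def add.commute)
      hence *: "c n * (?b (real (n + p)) - ?b (real p)) = ?b (real p) * ?S"
        by (simp add: algebra_simps)
      have "?b (real (n + p)) - ?b (real p) \<noteq> 0"
        using gap[OF n] by (simp flip: of_real_diff)
      thus ?thesis using * by (simp add: psi_coeff_def eq_divide_eq)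
    qed
  qed (use AB n in auto)
  moreover have "norm (c n) = norm (taylor_coeff f (p + n)) * Lambda_coeff q \<mu> (n + p)"
    using n Lambda_coeff_pos[OF q \<mu>, of "n + p"]
    by (simp add: c_def p_valent_fps_def norm_mult add.commute)
  ultimately show ?thesis
    using Lambda_coeff_pos[OF q \<mu>, of "n + p"] by (simp add: field_simps)
qed

text \<open>Uniqueness of power series identifies the given coefficients \<open>b\<close> with those in the definition
  of \<open>q_Bernardi\<close>, whose series converges because its multipliers lie between \<open>0\<close> and \<open>1\<close>:
  the q-bracket is increasing.\<close>
lemma q_Bernardi_coeff:
  assumes q: "0 < q" "q < 1" and \<eta>: "\<eta> > - real p"
    and hol: "f holomorphic_on \<D>"
    and b: "p_valent_expansion p (q_Bernardi p q \<eta> f) b" and n: "n > 0"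
  shows "b (p + n) = of_real (q_bracket q (\<eta> + real p) / q_bracket q (\<eta> + real p + real n))
                     * taylor_coeff f (p + n)"
proof -
  let ?l = "\<lambda>m. q_bracket q (\<eta> + real p) / q_bracket q (\<eta> + real m)"
  have "(\<lambda>z. z ^ p + (\<Sum>n. of_real (?l (Suc n + p)) * taylor_coeff f (Suc n + p) * z ^ (Suc n + p)))
      has_fps_expansion p_valent_fps p (\<lambda>m. of_real (?l m) * taylor_coeff f m)"
  proof (rule p_valent_multiplier_has_fps_expansion[OF hol])
    show "\<bar>?l m\<bar> \<le> 1 ^ m" if "m > p" for m
    proof -
      have "0 < q_bracket q (\<eta> + real p)" "q_bracket q (\<eta> + real p) < q_bracket q (\<eta> + real m)"
        using \<eta> that by (auto intro!: q_bracket_pos q_bracket_strict_mono q)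
      thus ?thesis by simp
    qed
  qed simp
  also have "(\<lambda>z. z ^ p + (\<Sum>n. of_real (?l (Suc n + p)) * taylor_coeff f (Suc n + p) * z ^ (Suc n + p)))
      = q_Bernardi p q \<eta> f"
    by (intro ext) (simp add: q_Bernardi_def add_ac)
  finally have "q_Bernardi p q \<eta> f has_fps_expansion
      p_valent_fps p (\<lambda>m. of_real (?l m) * taylor_coeff f m)" .
  moreover have "q_Bernardi p q \<eta> f has_fps_expansion p_valent_fps p b"
    using b by (intro has_fps_expansion_p_valentI[of 1]) (auto simp: p_valent_expansion_def)
  ultimately have "p_valent_fps p (\<lambda>m. of_real (?l m) * taylor_coeff f m) = p_valent_fps p b"
    by (rule fps_expansion_unique_complex)
  from arg_cong[OF this, of "\<lambda>h. fps_nth h (p + n)"] n show ?thesis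
    by (simp add: p_valent_fps_def add.assoc)
qed

theorem theorem3p8:
  fixes p :: nat and q \<mu> A B \<eta> :: real
    and f :: "complex \<Rightarrow> complex" and b :: "nat \<Rightarrow> complex"
  assumes "p \<ge> 1" and "0 < q" and "q < 1" and "\<mu> > -1"
    and "-1 \<le> B" and "B < A" and "A \<le> 1" and "\<eta> > - real p"
    and "f \<in> class_S p q \<mu> A B"
    and "p_valent_expansion p (q_Bernardi p q \<eta> f) b"
  shows "norm (b (p + 1)) \<le>
           q_bracket q (\<eta> + real p) / q_bracket q (\<eta> + real p + 1)
           * (psi_coeff q p 1 * (A - B) / Lambda_coeff q \<mu> (1 + p))
       \<and> (\<forall>n\<ge>2. norm (b (p + n)) \<le>
           q_bracket q (\<eta> + real p) / q_bracket q (\<eta> + real p + real n)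
           * ((A - B) * psi_coeff q p n / Lambda_coeff q \<mu> (n + p))
           * (\<Prod>t=1..n-1. 1 + q_bracket q (real p) * (A - B)
                                / (q_bracket q (real (p + t)) - q_bracket q (real p))))"
proof -
  have hol: "f holomorphic_on \<D>"
    using assms(9) by (auto simp: class_S_def class_A_def)
  have bound: "norm (b (p + n)) \<le>
           q_bracket q (\<eta> + real p) / q_bracket q (\<eta> + real p + real n)
           * ((A - B) * psi_coeff q p n / Lambda_coeff q \<mu> (n + p))
           * (\<Prod>t=1..n-1. 1 + q_bracket q (real p) * (A - B)
                                / (q_bracket q (real (p + t)) - q_bracket q (real p)))"
    if n: "n > 0" for n
  proof -
    let ?r = "q_bracket q (\<eta> + real p) / q_bracket q (\<eta> + real p + real n)"
    have r: "?r \<ge> 0"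
      using assms by (intro divide_nonneg_nonneg less_imp_le[OF q_bracket_pos]) auto
    have "norm (b (p + n)) = ?r * norm (taylor_coeff f (p + n))"
      unfolding q_Bernardi_coeff[OF assms(2,3,8) hol assms(10) n] norm_mult norm_of_real
      by (simp only: abs_of_nonneg[OF r])
    also have "\<dots> \<le> ?r * ((A - B) * psi_coeff q p n / Lambda_coeff q \<mu> (n + p)
        * (\<Prod>t=1..n-1. 1 + psi_coeff q p t * (A - B)))"
      by (intro mult_left_mono class_S_taylor_coeff_bound assms n r)
    finally show ?thesis by (simp add: psi_coeff_def add.commute mult.assoc)
  qed
  show ?thesis
    using bound[of 1] bound by (auto simp: mult.commute)
qed

end
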